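(* Let $A$ be a compatible associative algebra. If $H^2_c(A,A)=0$ then $A$ is rigid.
   Context: All vector spaces are finite-dimensional over a field $\mathbb{K}$ of characteristic $0$. A compatible associative algebra is a triple $(A,\mu_1,\mu_2)$ of a vector space with two associative bilinear products, written $a\cdot_1 b$ and $a\cdot_2 b$, with $(a\cdot_1 b)\cdot_2 c+(a\cdot_2 b)\cdot_1 c=a\cdot_1(b\cdot_2 c)+a\cdot_2(b\cdot_1 c)$ for all $a,b,c$ (and similarly over a commutative ring). Morphisms are linear maps preserving both products. Cohomology: let $C^n(A,A)=\mathrm{Hom}(A^{\otimes n},A)$ and, for $i=1,2$, let $\delta_i:C^n(A,A)\to C^{n+1}(A,A)$ be the Hochschild coboundary of $(A,\mu_i)$: $(\delta_if)(a_1,\ldots,a_{n+1})=a_1\cdot_if(a_2,\ldots,a_{n+1})+\sum_{k=1}^n(-1)^kf(a_1,\ldots,a_k\cdot_ia_{k+1},\ldots,a_{n+1})+(-1)^{n+1}f(a_1,\ldots,a_n)\cdot_ia_{n+1}$. $H^*_c(A,A)$ is the cohomology of the complex with $C^0_c(A,A)=\{m\in A\mid a\cdot_1m-m\cdot_1a=a\cdot_2m-m\cdot_2a\ \forall a\in A\}$, $C^n_c(A,A)=C^n(A,A)^{\oplus n}$ for $n\ge1$, $\delta_c(m)(a)=a\cdot_1m-m\cdot_1a=a\cdot_2m-m\cdot_2a$ on $C^0_c$, and $\delta_c(f_1,\ldots,f_n)=(\delta_1f_1,\ldots,\delta_1f_i+\delta_2f_{i-1},\ldots,\delta_2f_n)$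 for $n\ge1$ (the $i$-th entry being $\delta_1f_i+\delta_2f_{i-1}$ for $2\le i\le n$). A formal deformation of $A$ consists of two formal power series $\mu_{1,t}=\sum_{i\ge0}t^i\mu_{1,i}$, $\mu_{2,t}=\sum_{i\ge0}t^i\mu_{2,i}$ with $\mu_{1,i},\mu_{2,i}$ bilinear maps on $A$, $\mu_{1,0}=\mu_1$, $\mu_{2,0}=\mu_2$, such that $(A[[t]],\mu_{1,t},\mu_{2,t})$ (with $\mathbb{K}[[t]]$-bilinear extension) is a compatible associative algebra over $\mathbb{K}[[t]]$. Two formal deformations $(\mu_{1,t},\mu_{2,t})$, $(\mu_{1,t}',\mu_{2,t}')$ are equivalent if there is a formal power series $\phi_t=\sum_{i\ge0}t^i\phi_i$ of linear maps $\phi_i:A\to A$ with $\phi_0=\mathrm{id}_A$ such that the $\mathbb{K}[[t]]$-linear map $\phi_t:(A[[t]],\mu_{1,t},\mu_{2,t})\to(A[[t]],\mu_{1,t}',\mu_{2,t}')$ is a morphism of compatible associative algebras. $A$ is rigid if every formal deformation of $A$ is equivalent to the undeformed one $(\mu_1,\mu_2)$. *)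

theory Defs
  imports
    "HOL-Computational_Algebra.Formal_Power_Series"
    "HOL-Library.Function_Algebras"
begin

section \<open>Compatible associative algebras\<close>

definition bilinear_product ::
  "('k::comm_ring_1 \<Rightarrow> 'a::ab_group_add \<Rightarrow> 'a) \<Rightarrow> ('a \<Rightarrow> 'a \<Rightarrow> 'a) \<Rightarrow> bool" where
  "bilinear_product scale m \<longleftrightarrow>
     (\<forall>a. module_hom scale scale (\<lambda>b. m a b)) \<and>
     (\<forall>b. module_hom scale scale (\<lambda>a. m a b))"

locale compatible_algebra = module scale
  for scale :: "'k::comm_ring_1 \<Rightarrow> 'a::ab_group_add \<Rightarrow> 'a" +
  fixes mul1 mul2 :: "'a \<Rightarrow> 'a \<Rightarrow> 'a"
  assumes bilinear1: "bilinear_product scale mul1"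
    and bilinear2: "bilinear_product scale mul2"
    and assoc1: "mul1 (mul1 a b) c = mul1 a (mul1 b c)"
    and assoc2: "mul2 (mul2 a b) c = mul2 a (mul2 b c)"
    and compatible: "mul2 (mul1 a b) c + mul1 (mul2 a b) c = mul1 a (mul2 b c) + mul2 a (mul1 b c)"

definition compatible_algebra_hom ::
  "('k::comm_ring_1 \<Rightarrow> 'a::ab_group_add \<Rightarrow> 'a) \<Rightarrow> ('a \<Rightarrow> 'a \<Rightarrow> 'a) \<Rightarrow> ('a \<Rightarrow> 'a \<Rightarrow> 'a) \<Rightarrow>
   ('k \<Rightarrow> 'b::ab_group_add \<Rightarrow> 'b) \<Rightarrow> ('b \<Rightarrow> 'b \<Rightarrow> 'b) \<Rightarrow> ('b \<Rightarrow> 'b \<Rightarrow> 'b) \<Rightarrow> ('a \<Rightarrow> 'b) \<Rightarrow> bool" where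
  "compatible_algebra_hom scale mul1 mul2 scale' mul1' mul2' f \<longleftrightarrow>
     module_hom scale scale' f \<and>
     (\<forall>a b. f (mul1 a b) = mul1' (f a) (f b)) \<and>
     (\<forall>a b. f (mul2 a b) = mul2' (f a) (f b))"


section \<open>Cohomology\<close>

text \<open>An element of \<open>Hom(A\<^sup>\<otimes>\<^sup>n, A)\<close> is encoded as an \<open>n\<close>-multilinear function on argument
  lists of length \<open>n\<close>; it is set to \<open>0\<close> on lists of any other length so that equality of functions
  is equality of cochains.\<close>

definition hochschild_cochains ::
  "('k::comm_ring_1 \<Rightarrow> 'a::ab_group_add \<Rightarrow> 'a) \<Rightarrow> nat \<Rightarrow> ('a list \<Rightarrow> 'a) set" where
  "hochschild_cochains scale n = {f.
     (\<forall>xs ys. length xs + 1 + length ys = n \<longrightarrow> module_hom scale scale (\<lambda>a. f (xs @ a # ys))) \<and>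
     (\<forall>as. length as \<noteq> n \<longrightarrow> f as = 0)}"

text \<open>List positions start at \<open>0\<close>, so \<open>a\<^sub>k\<close> is \<open>as ! (k - 1)\<close>.\<close>

definition hochschild_coboundary ::
  "('k::comm_ring_1 \<Rightarrow> 'a::ab_group_add \<Rightarrow> 'a) \<Rightarrow> ('a \<Rightarrow> 'a \<Rightarrow> 'a) \<Rightarrow> nat \<Rightarrow>
   ('a list \<Rightarrow> 'a) \<Rightarrow> 'a list \<Rightarrow> 'a" where
  "hochschild_coboundary scale m n f = (\<lambda>as.
     if length as = n + 1 then
       m (hd as) (f (tl as))
       + (\<Sum>k=1..n. scale ((-1) ^ k)
            (f (take (k - 1) as @ m (as ! (k - 1)) (as ! k) # drop (k + 1) as)))
       + scale ((-1) ^ (n + 1)) (m (f (butlast as)) (last as))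
     else 0)"

text \<open>A cochain of degree \<open>n \<ge> 1\<close> is a tuple \<open>(F 1, \<dots>, F n)\<close>, with \<open>F i = 0\<close> for the unused
  indices \<open>i\<close>. A cochain of degree \<open>0\<close>, that is, an element \<open>m\<close> of \<open>A\<close> for which the two commutators
  agree, is stored as the value \<open>F 1 []\<close>, all other entries and values being \<open>0\<close>.\<close>

definition compatible_cochains ::
  "('k::comm_ring_1 \<Rightarrow> 'a::ab_group_add \<Rightarrow> 'a) \<Rightarrow> ('a \<Rightarrow> 'a \<Rightarrow> 'a) \<Rightarrow> ('a \<Rightarrow> 'a \<Rightarrow> 'a) \<Rightarrow> nat \<Rightarrow>
   (nat \<Rightarrow> 'a list \<Rightarrow> 'a) set" where
  "compatible_cochains scale mul1 mul2 n = {F.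
     (\<forall>i\<in>{1..max 1 n}. F i \<in> hochschild_cochains scale n) \<and>
     (\<forall>i. i \<notin> {1..max 1 n} \<longrightarrow> F i = 0) \<and>
     (n = 0 \<longrightarrow> (\<forall>a. mul1 a (F 1 []) - mul1 (F 1 []) a = mul2 a (F 1 []) - mul2 (F 1 []) a))}"

text \<open>For \<open>n = 0\<close> only the first branch is relevant, and it gives \<open>a \<mapsto> a \<cdot>\<^sub>1 m - m \<cdot>\<^sub>1 a\<close>.\<close>

definition compatible_coboundary ::
  "('k::comm_ring_1 \<Rightarrow> 'a::ab_group_add \<Rightarrow> 'a) \<Rightarrow> ('a \<Rightarrow> 'a \<Rightarrow> 'a) \<Rightarrow> ('a \<Rightarrow> 'a \<Rightarrow> 'a) \<Rightarrow> nat \<Rightarrow>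
   (nat \<Rightarrow> 'a list \<Rightarrow> 'a) \<Rightarrow> nat \<Rightarrow> 'a list \<Rightarrow> 'a" where
  "compatible_coboundary scale mul1 mul2 n F = (\<lambda>i.
     if i = 1 then hochschild_coboundary scale mul1 n (F 1)
     else if 2 \<le> i \<and> i \<le> n then
       hochschild_coboundary scale mul1 n (F i) + hochschild_coboundary scale mul2 n (F (i - 1))
     else if i = n + 1 then hochschild_coboundary scale mul2 n (F n)
     else 0)"

definition compatible_cocycles ::
  "('k::comm_ring_1 \<Rightarrow> 'a::ab_group_add \<Rightarrow> 'a) \<Rightarrow> ('a \<Rightarrow> 'a \<Rightarrow> 'a) \<Rightarrow> ('a \<Rightarrow> 'a \<Rightarrow> 'a) \<Rightarrow> nat \<Rightarrow>
   (nat \<Rightarrow> 'a list \<Rightarrow> 'a) set" where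
  "compatible_cocycles scale mul1 mul2 n =
     {F \<in> compatible_cochains scale mul1 mul2 n. compatible_coboundary scale mul1 mul2 n F = 0}"

definition compatible_coboundaries ::
  "('k::comm_ring_1 \<Rightarrow> 'a::ab_group_add \<Rightarrow> 'a) \<Rightarrow> ('a \<Rightarrow> 'a \<Rightarrow> 'a) \<Rightarrow> ('a \<Rightarrow> 'a \<Rightarrow> 'a) \<Rightarrow> nat \<Rightarrow>
   (nat \<Rightarrow> 'a list \<Rightarrow> 'a) set" where
  "compatible_coboundaries scale mul1 mul2 n =
     (if n = 0 then {0}
      else compatible_coboundary scale mul1 mul2 (n - 1) ` compatible_cochains scale mul1 mul2 (n - 1))"

text \<open>The quotient of cocycles by coboundaries, as a set of cosets. Its zero element is the coset
  \<open>compatible_coboundaries scale mul1 mul2 n\<close>.\<close>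

definition compatible_cohomology ::
  "('k::comm_ring_1 \<Rightarrow> 'a::ab_group_add \<Rightarrow> 'a) \<Rightarrow> ('a \<Rightarrow> 'a \<Rightarrow> 'a) \<Rightarrow> ('a \<Rightarrow> 'a \<Rightarrow> 'a) \<Rightarrow> nat \<Rightarrow>
   (nat \<Rightarrow> 'a list \<Rightarrow> 'a) set set" where
  "compatible_cohomology scale mul1 mul2 n =
     compatible_cocycles scale mul1 mul2 n //
       {(F, G). F \<in> compatible_cocycles scale mul1 mul2 n \<and> G \<in> compatible_cocycles scale mul1 mul2 n \<and>
                F - G \<in> compatible_coboundaries scale mul1 mul2 n}"


section \<open>Formal deformations\<close>

text \<open>\<open>A[[t]]\<close> is the type \<open>'a fps\<close>, a module over the ring \<open>'k fps\<close>.\<close>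

definition fps_scale ::
  "('k::comm_ring_1 \<Rightarrow> 'a::ab_group_add \<Rightarrow> 'a) \<Rightarrow> 'k fps \<Rightarrow> 'a fps \<Rightarrow> 'a fps" where
  "fps_scale scale r x = Abs_fps (\<lambda>n. \<Sum>i\<le>n. scale (fps_nth r i) (fps_nth x (n - i)))"

text \<open>The \<open>'k fps\<close>-bilinear (linear) extension of a power series of bilinear (linear) maps.\<close>

definition fps_product :: "(nat \<Rightarrow> 'a \<Rightarrow> 'a \<Rightarrow> 'a) \<Rightarrow> 'a::ab_group_add fps \<Rightarrow> 'a fps \<Rightarrow> 'a fps" where
  "fps_product M x y =
     Abs_fps (\<lambda>n. \<Sum>i\<le>n. \<Sum>j\<le>n - i. M i (fps_nth x j) (fps_nth y (n - i - j)))"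

definition fps_map :: "(nat \<Rightarrow> 'a \<Rightarrow> 'a) \<Rightarrow> 'a::ab_group_add fps \<Rightarrow> 'a fps" where
  "fps_map \<phi> x = Abs_fps (\<lambda>n. \<Sum>i\<le>n. \<phi> i (fps_nth x (n - i)))"

definition formal_deformation ::
  "('k::comm_ring_1 \<Rightarrow> 'a::ab_group_add \<Rightarrow> 'a) \<Rightarrow> ('a \<Rightarrow> 'a \<Rightarrow> 'a) \<Rightarrow> ('a \<Rightarrow> 'a \<Rightarrow> 'a) \<Rightarrow>
   (nat \<Rightarrow> 'a \<Rightarrow> 'a \<Rightarrow> 'a) \<Rightarrow> (nat \<Rightarrow> 'a \<Rightarrow> 'a \<Rightarrow> 'a) \<Rightarrow> bool" where
  "formal_deformation scale mul1 mul2 M1 M2 \<longleftrightarrow>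
     (\<forall>i. bilinear_product scale (M1 i) \<and> bilinear_product scale (M2 i)) \<and>
     M1 0 = mul1 \<and> M2 0 = mul2 \<and>
     compatible_algebra (fps_scale scale) (fps_product M1) (fps_product M2)"

definition equivalent_deformations ::
  "('k::comm_ring_1 \<Rightarrow> 'a::ab_group_add \<Rightarrow> 'a) \<Rightarrow>
   (nat \<Rightarrow> 'a \<Rightarrow> 'a \<Rightarrow> 'a) \<Rightarrow> (nat \<Rightarrow> 'a \<Rightarrow> 'a \<Rightarrow> 'a) \<Rightarrow>
   (nat \<Rightarrow> 'a \<Rightarrow> 'a \<Rightarrow> 'a) \<Rightarrow> (nat \<Rightarrow> 'a \<Rightarrow> 'a \<Rightarrow> 'a) \<Rightarrow> bool" where
  "equivalent_deformations scale M1 M2 M1' M2' \<longleftrightarrow>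
     (\<exists>\<phi>. (\<forall>i. module_hom scale scale (\<phi> i)) \<and> \<phi> 0 = id \<and>
        compatible_algebra_hom (fps_scale scale) (fps_product M1) (fps_product M2)
          (fps_scale scale) (fps_product M1') (fps_product M2') (fps_map \<phi>))"

definition constant_series :: "('a \<Rightarrow> 'a \<Rightarrow> 'a) \<Rightarrow> nat \<Rightarrow> 'a \<Rightarrow> 'a \<Rightarrow> 'a::ab_group_add" where
  "constant_series m i = (if i = 0 then m else 0)"

definition rigid ::
  "('k::comm_ring_1 \<Rightarrow> 'a::ab_group_add \<Rightarrow> 'a) \<Rightarrow> ('a \<Rightarrow> 'a \<Rightarrow> 'a) \<Rightarrow> ('a \<Rightarrow> 'a \<Rightarrow> 'a) \<Rightarrow> bool" where
  "rigid scale mul1 mul2 \<longleftrightarrow>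
     (\<forall>M1 M2. formal_deformation scale mul1 mul2 M1 M2 \<longrightarrow>
        equivalent_deformations scale M1 M2 (constant_series mul1) (constant_series mul2))"

end

theory Submission
  imports Defs
begin

text \<open>
  Write \<open>\<mu>\<close> for the constant extension of a product \<open>m\<close> of \<open>A\<close> to \<open>A[[t]]\<close> and \<open>M\<close> for its
  deformation. An equivalence with the undeformed algebra is a series \<open>\<phi>\<close> with \<open>\<phi>\<^sub>0 = id\<close> whose
  defect \<open>E(x, y) = \<phi>(M(x, y)) - \<mu>(\<phi> x, \<phi> y)\<close> vanishes for both products. In degree \<open>n > 0\<close> and on
  constant series this is an equation \<open>\<delta> \<phi>\<^sub>n = O\<^sub>n\<close> in which \<open>O\<^sub>n\<close>, the \<open>obstruction\<close>, depends only
  on \<open>\<phi>\<^sub>0, \<dots>, \<phi>\<^sub>n\<^sub>-\<^sub>1\<close>. So \<open>\<phi>\<close> can be constructed recursively, without revising earlier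
  coefficients and without composing infinitely many equivalences, as soon as the pair of
  obstructions is a compatible 2-cocycle; the vanishing of the second cohomology then provides
  \<open>\<phi>\<^sub>n\<close>, the same map for both products.

  The cocycle property comes from expanding \<open>\<phi>\<close> of a product of three factors with two defects:
  \<open>\<phi>(M'(M(a, b), c)) - \<mu>'(\<mu>(\<phi> a, \<phi> b), \<phi> c) = E'(M(a, b), c) + \<mu>'(E(a, b), \<phi> c)\<close>,
  and symmetrically for the other bracketing. Associativity and compatibility of \<open>(M\<^sub>1, M\<^sub>2)\<close> and of
  \<open>(\<mu>\<^sub>1, \<mu>\<^sub>2)\<close> make suitable sums of the left-hand sides for the two bracketings equal
  (\<open>hom_defect_left_nested\<close>, \<open>hom_defect_right_nested\<close>). If the defects vanish on constants in all
  degrees below \<open>n\<close>, then \<open>K[[t]]\<close>-bilinearity reduces the right-hand sides in degree \<open>n\<close> to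
  \<open>O'\<^sub>n(m(a, b), c) + m'(O\<^sub>n(a, b), c)\<close>, and the three resulting identities are exactly the cocycle
  condition (\<open>hom_defect_compatible_2_cocycle\<close>).
\<close>

section \<open>Modules of formal power series\<close>

lemma bilinear_product_iff:
  "bilinear_product scale m \<longleftrightarrow>
     module scale \<and>
     (\<forall>a b c. m a (b + c) = m a b + m a c) \<and> (\<forall>a b r. m a (scale r b) = scale r (m a b)) \<and>
     (\<forall>a b c. m (a + b) c = m a c + m b c) \<and> (\<forall>a b r. m (scale r a) b = scale r (m a b))"
  unfolding bilinear_product_def module_hom_iff by blast

lemma bilinear_product_group_homs:
  assumes "bilinear_product scale m"
  shows "m a 0 = 0" "m 0 b = 0"
    "m a (b - c) = m a b - m a c" "m (a - b) c = m a c - m b c"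
    "m a (sum g I) = (\<Sum>i\<in>I. m a (g i))" "m (sum g I) b = (\<Sum>i\<in>I. m (g i) b)"
proof -
  interpret l: module_hom scale scale "\<lambda>b. m a b" for a
    using assms by (simp add: bilinear_product_def)
  interpret r: module_hom scale scale "\<lambda>a. m a b" for b
    using assms by (simp add: bilinear_product_def)
  show "m a 0 = 0" "m 0 b = 0"
    "m a (b - c) = m a b - m a c" "m (a - b) c = m a c - m b c"
    "m a (sum g I) = (\<Sum>i\<in>I. m a (g i))" "m (sum g I) b = (\<Sum>i\<in>I. m (g i) b)"
    by (simp_all add: l.zero r.zero l.diff r.diff l.sum r.sum)
qed

lemma fps_nth_fps_scale [simp]:
  "fps_nth (fps_scale scale r x) n = (\<Sum>i\<le>n. scale (fps_nth r i) (fps_nth x (n - i)))"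
  by (simp add: fps_scale_def)

lemma fps_nth_fps_map [simp]:
  "fps_nth (fps_map \<phi> x) n = (\<Sum>i\<le>n. \<phi> i (fps_nth x (n - i)))"
  by (simp add: fps_map_def)

lemma fps_nth_fps_product:
  "fps_nth (fps_product M x y) n =
     (\<Sum>i\<le>n. \<Sum>j\<le>n - i. M i (fps_nth x j) (fps_nth y (n - i - j)))"
  by (simp add: fps_product_def)

lemma fps_nth_fps_product_constant_series [simp]:
  "fps_nth (fps_product (constant_series m) x y) n = (\<Sum>j\<le>n. m (fps_nth x j) (fps_nth y (n - j)))"
proof -
  have "(\<Sum>j\<le>n - i. constant_series m i (fps_nth x j) (fps_nth y (n - i - j))) =
      (if i = 0 then \<Sum>j\<le>n. m (fps_nth x j) (fps_nth y (n - j)) else 0)" for i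
    by (simp add: constant_series_def)
  then show ?thesis by (simp add: fps_nth_fps_product)
qed

text \<open>Both sides of each of the next two identities sum \<open>f i j k\<close> over all \<open>i + j + k = n\<close>. They
  carry every manipulation of nested Cauchy products below: the first regroups the factors, the
  second moves a scalar series out of an inner factor.\<close>

lemma sum_triples_assoc:
  fixes f :: "nat \<Rightarrow> nat \<Rightarrow> nat \<Rightarrow> 'a::comm_monoid_add"
  shows "(\<Sum>j\<le>n. \<Sum>i\<le>j. f i (j - i) (n - j)) = (\<Sum>i\<le>n. \<Sum>j\<le>n - i. f i j (n - i - j))"
  using fps_mult_assoc_lemma[where f = f and n = n and k = n] by (simp add: atLeast0AtMost)

lemma sum_triples_swap:
  fixes f :: "nat \<Rightarrow> nat \<Rightarrow> nat \<Rightarrow> 'a::comm_monoid_add"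
  shows "(\<Sum>i\<le>n. \<Sum>j\<le>n - i. f i j (n - i - j)) = (\<Sum>j\<le>n. \<Sum>i\<le>n - j. f i j (n - j - i))"
proof -
  have range: "{..n - i} = {j \<in> {..n}. i + j \<le> n}" if "i \<le> n" for i
    using that by auto
  have range': "{..n - j} = {i \<in> {..n}. i + j \<le> n}" if "j \<le> n" for j
    using that by auto
  have "(\<Sum>i\<le>n. \<Sum>j\<le>n - i. f i j (n - i - j)) =
      (\<Sum>i\<le>n. \<Sum>j\<in>{j \<in> {..n}. i + j \<le> n}. f i j (n - i - j))"
    by (rule sum.cong) (simp_all add: range)
  also have "\<dots> = (\<Sum>j\<le>n. \<Sum>i\<in>{i \<in> {..n}. i + j \<le> n}. f i j (n - i - j))"
    by (rule sum.swap_restrict) simp_all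
  also have "\<dots> = (\<Sum>j\<le>n. \<Sum>i\<le>n - j. f i j (n - j - i))"
    by (rule sum.cong) (simp_all add: range' add.commute)
  finally show ?thesis .
qed

lemma module_fps_scale:
  assumes "module scale"
  shows "module (fps_scale scale)"
proof -
  interpret module scale by fact
  show ?thesis
  proof
    fix r s and x y :: "'b fps"
    show "fps_scale scale r (x + y) = fps_scale scale r x + fps_scale scale r y"
      by (rule fps_ext) (simp add: scale_right_distrib sum.distrib)
    show "fps_scale scale (r + s) x = fps_scale scale r x + fps_scale scale s x"
      by (rule fps_ext) (simp add: scale_left_distrib sum.distrib)
    show "fps_scale scale r (fps_scale scale s x) = fps_scale scale (r * s) x"
    proof (rule fps_ext)
      fix n
      have "fps_nth (fps_scale scale r (fps_scale scale s x)) n =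
          (\<Sum>i\<le>n. \<Sum>j\<le>n - i. scale (fps_nth r i * fps_nth s j) (fps_nth x (n - i - j)))"
        by (simp add: scale_sum_right)
      also have "\<dots> = (\<Sum>k\<le>n. \<Sum>i\<le>k. scale (fps_nth r i * fps_nth s (k - i)) (fps_nth x (n - k)))"
        by (rule sum_triples_assoc[symmetric])
      also have "\<dots> = fps_nth (fps_scale scale (r * s) x) n"
        by (simp add: fps_mult_nth scale_sum_left atLeast0AtMost)
      finally show "fps_nth (fps_scale scale r (fps_scale scale s x)) n =
          fps_nth (fps_scale scale (r * s) x) n" .
    qed
    show "fps_scale scale 1 x = x"
    proof (rule fps_ext)
      fix n
      have "scale (fps_nth 1 i) (fps_nth x (n - i)) = (if i = 0 then fps_nth x n else 0)" for i
        by simp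
      then show "fps_nth (fps_scale scale 1 x) n = fps_nth x n"
        by simp
    qed
  qed
qed

lemma module_hom_fps_map:
  assumes "\<And>i. module_hom scale scale (\<phi> i)"
  shows "module_hom (fps_scale scale) (fps_scale scale) (fps_map \<phi>)"
proof -
  interpret \<phi>: module_hom scale scale "\<phi> i" for i by fact
  interpret module "fps_scale scale"
    by (rule module_fps_scale) (rule \<phi>.m1.module_axioms)
  have "fps_map \<phi> (fps_scale scale r x) = fps_scale scale r (fps_map \<phi> x)" for r x
  proof (rule fps_ext)
    fix n
    have "fps_nth (fps_map \<phi> (fps_scale scale r x)) n =
        (\<Sum>i\<le>n. \<Sum>j\<le>n - i. scale (fps_nth r j) (\<phi> i (fps_nth x (n - i - j))))"
      by (simp add: \<phi>.sum \<phi>.scale)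
    also have "\<dots> = (\<Sum>j\<le>n. \<Sum>i\<le>n - j. scale (fps_nth r j) (\<phi> i (fps_nth x (n - j - i))))"
      by (rule sum_triples_swap)
    also have "\<dots> = fps_nth (fps_scale scale r (fps_map \<phi> x)) n"
      by (simp add: \<phi>.m1.scale_sum_right)
    finally show "fps_nth (fps_map \<phi> (fps_scale scale r x)) n =
        fps_nth (fps_scale scale r (fps_map \<phi> x)) n" .
  qed
  moreover have "fps_map \<phi> (x + y) = fps_map \<phi> x + fps_map \<phi> y" for x y
    by (rule fps_ext) (simp add: \<phi>.add sum.distrib)
  ultimately show ?thesis
    by (simp add: module_hom_iff module_axioms)
qed

lemma bilinear_product_constant_series:
  assumes "bilinear_product scale m"
  shows "bilinear_product (fps_scale scale) (fps_product (constant_series m))"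
proof -
  note m = assms[unfolded bilinear_product_iff] bilinear_product_group_homs[OF assms]
  interpret module scale using m by blast
  interpret fps: module "fps_scale scale" by (rule module_fps_scale) (rule module_axioms)
  let ?\<mu> = "fps_product (constant_series m)"
  have "?\<mu> x (y + z) = ?\<mu> x y + ?\<mu> x z" "?\<mu> (x + y) z = ?\<mu> x z + ?\<mu> y z" for x y z
    by (rule fps_ext, simp add: m sum.distrib)+
  moreover have "?\<mu> x (fps_scale scale r y) = fps_scale scale r (?\<mu> x y)" for r x y
  proof (rule fps_ext)
    fix n
    have "fps_nth (?\<mu> x (fps_scale scale r y)) n =
        (\<Sum>j\<le>n. \<Sum>i\<le>n - j. scale (fps_nth r i) (m (fps_nth x j) (fps_nth y (n - j - i))))"
      by (simp add: m)
    also have "\<dots> = (\<Sum>i\<le>n. \<Sum>j\<le>n - i. scale (fps_nth r i) (m (fps_nth x j) (fps_nth y (n - i - j))))"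
      by (rule sum_triples_swap)
    also have "\<dots> = fps_nth (fps_scale scale r (?\<mu> x y)) n"
      by (simp add: scale_sum_right)
    finally show "fps_nth (?\<mu> x (fps_scale scale r y)) n = fps_nth (fps_scale scale r (?\<mu> x y)) n" .
  qed
  moreover have "?\<mu> (fps_scale scale r x) y = fps_scale scale r (?\<mu> x y)" for r x y
  proof (rule fps_ext)
    fix n
    have "fps_nth (?\<mu> (fps_scale scale r x) y) n =
        (\<Sum>k\<le>n. \<Sum>i\<le>k. scale (fps_nth r i) (m (fps_nth x (k - i)) (fps_nth y (n - k))))"
      by (simp add: m)
    also have "\<dots> = (\<Sum>i\<le>n. \<Sum>j\<le>n - i. scale (fps_nth r i) (m (fps_nth x j) (fps_nth y (n - i - j))))"
      by (rule sum_triples_assoc)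
    also have "\<dots> = fps_nth (fps_scale scale r (?\<mu> x y)) n"
      by (simp add: scale_sum_right)
    finally show "fps_nth (?\<mu> (fps_scale scale r x) y) n = fps_nth (fps_scale scale r (?\<mu> x y)) n" .
  qed
  ultimately show ?thesis
    by (simp add: bilinear_product_iff fps.module_axioms)
qed

lemma compatible_algebra_constant_series:
  assumes "compatible_algebra scale mul1 mul2"
  shows "compatible_algebra (fps_scale scale)
    (fps_product (constant_series mul1)) (fps_product (constant_series mul2))"
proof -
  interpret compatible_algebra scale mul1 mul2 by fact
  interpret fps: module "fps_scale scale" by (rule module_fps_scale) (rule module_axioms)
  have left: "fps_nth (fps_product (constant_series m) (fps_product (constant_series m') x y) z) n =
      (\<Sum>i\<le>n. \<Sum>j\<le>n - i. m (m' (fps_nth x i) (fps_nth y j)) (fps_nth z (n - i - j)))"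
    if "bilinear_product scale m" for m m' x y z n
    using sum_triples_assoc[of "\<lambda>i j k. m (m' (fps_nth x i) (fps_nth y j)) (fps_nth z k)"]
    by (simp add: bilinear_product_group_homs[OF that])
  have right: "fps_nth (fps_product (constant_series m) x (fps_product (constant_series m') y z)) n =
      (\<Sum>i\<le>n. \<Sum>j\<le>n - i. m (fps_nth x i) (m' (fps_nth y j) (fps_nth z (n - i - j))))"
    if "bilinear_product scale m" for m m' x y z n
    by (simp add: bilinear_product_group_homs[OF that])
  show ?thesis
  proof
    show "bilinear_product (fps_scale scale) (fps_product (constant_series mul1))"
      "bilinear_product (fps_scale scale) (fps_product (constant_series mul2))"
      by (intro bilinear_product_constant_series bilinear1 bilinear2)+
  qed (rule fps_ext,
      simp add: left right bilinear1 bilinear2 assoc1 assoc2 compatible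
        sum.distrib[symmetric] del: fps_nth_fps_product_constant_series)+
qed

section \<open>Second cohomology\<close>

text \<open>The Hochschild differentials in degrees 1 and 2 on curried maps, so that bilinear maps need not
  be handled as functions on argument lists.\<close>

definition hochschild_d1 :: "('a \<Rightarrow> 'a \<Rightarrow> 'a::ab_group_add) \<Rightarrow> ('a \<Rightarrow> 'a) \<Rightarrow> 'a \<Rightarrow> 'a \<Rightarrow> 'a" where
  "hochschild_d1 m g a b = m a (g b) - g (m a b) + m (g a) b"

definition hochschild_d2 ::
  "('a \<Rightarrow> 'a \<Rightarrow> 'a::ab_group_add) \<Rightarrow> ('a \<Rightarrow> 'a \<Rightarrow> 'a) \<Rightarrow> 'a \<Rightarrow> 'a \<Rightarrow> 'a \<Rightarrow> 'a" where
  "hochschild_d2 m f a b c = m a (f b c) - f (m a b) c + f a (m b c) - m (f a b) c"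

lemma hochschild_coboundary_1:
  assumes "module scale"
  shows "hochschild_coboundary scale m 1 f [a, b] = hochschild_d1 m (\<lambda>a. f [a]) a b"
proof -
  interpret module scale by fact
  show ?thesis by (simp add: hochschild_coboundary_def hochschild_d1_def)
qed

lemma hochschild_coboundary_2:
  assumes "module scale"
  shows "hochschild_coboundary scale m 2 f [a, b, c] = hochschild_d2 m (\<lambda>a b. f [a, b]) a b c"
proof -
  interpret module scale by fact
  have "{1..2::nat} = {1, 2}" by auto
  then show ?thesis by (simp add: hochschild_coboundary_def hochschild_d2_def)
qed

lemma hochschild_coboundary_other_length:
  "length as \<noteq> n + 1 \<Longrightarrow> hochschild_coboundary scale m n f as = 0"
  by (simp add: hochschild_coboundary_def)

text \<open>Needed for cosets to contain their representatives: \<open>F\<close> lies in its own class only because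
  \<open>F - F\<close> is a coboundary.\<close>

lemma zero_in_compatible_coboundaries_2:
  assumes "compatible_algebra scale mul1 mul2"
  shows "0 \<in> compatible_coboundaries scale mul1 mul2 2"
proof -
  interpret compatible_algebra scale mul1 mul2 by fact
  have zero: "hochschild_coboundary scale m 1 0 = 0" if "bilinear_product scale m" for m
    by (simp add: hochschild_coboundary_def fun_eq_iff bilinear_product_group_homs[OF that])
  have "compatible_coboundary scale mul1 mul2 1 0 = 0"
    by (simp add: compatible_coboundary_def fun_eq_iff zero[OF bilinear1, simplified] zero[OF bilinear2, simplified])
  moreover have "0 \<in> compatible_cochains scale mul1 mul2 1"
    by (simp add: compatible_cochains_def hochschild_cochains_def module_hom_iff module_axioms)
  ultimately show ?thesis
    by (auto simp: compatible_coboundaries_def image_iff intro!: bexI[of _ 0])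
qed

lemma compatible_cocycles_2_subset_coboundaries:
  assumes "compatible_algebra scale mul1 mul2"
    and "compatible_cohomology scale mul1 mul2 2 = {compatible_coboundaries scale mul1 mul2 2}"
  shows "compatible_cocycles scale mul1 mul2 2 \<subseteq> compatible_coboundaries scale mul1 mul2 2"
proof
  let ?Z = "compatible_cocycles scale mul1 mul2 2" and ?B = "compatible_coboundaries scale mul1 mul2 2"
  let ?R = "{(F, G). F \<in> ?Z \<and> G \<in> ?Z \<and> F - G \<in> ?B}"
  fix F assume F: "F \<in> ?Z"
  then have "?R `` {F} \<in> compatible_cohomology scale mul1 mul2 2"
    unfolding compatible_cohomology_def by (rule quotientI)
  then have "?R `` {F} = ?B"
    using assms(2) by simp
  moreover have "F \<in> ?R `` {F}"
    using F zero_in_compatible_coboundaries_2[OF assms(1)] by simp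
  ultimately show "F \<in> ?B" by blast
qed

lemma bilinear_2_cochain:
  assumes "bilinear_product scale f"
  shows "(\<lambda>as. if length as = 2 then f (as ! 0) (as ! 1) else 0) \<in> hochschild_cochains scale 2"
proof -
  have "module_hom scale scale (\<lambda>a. f ((xs @ a # ys) ! 0) ((xs @ a # ys) ! 1))"
    if "length xs + 1 + length ys = 2" for xs ys
  proof -
    from that consider u where "xs = []" "ys = [u]" | u where "xs = [u]" "ys = []"
      by (cases xs; cases ys) auto
    then show ?thesis
      using assms by cases (simp_all add: bilinear_product_def)
  qed
  then show ?thesis
    by (auto simp: hochschild_cochains_def)
qed

text \<open>The form in which the vanishing of the second cohomology is used. A 1-cochain is a single linear
  map, not one for each product, hence the same \<open>g\<close> solves both equations.\<close>

lemma compatible_2_cocycle_is_coboundary: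
  assumes alg: "compatible_algebra scale mul1 mul2"
    and H2: "compatible_cohomology scale mul1 mul2 2 = {compatible_coboundaries scale mul1 mul2 2}"
    and f1: "bilinear_product scale f1" and f2: "bilinear_product scale f2"
    and cocycle1: "\<And>a b c. hochschild_d2 mul1 f1 a b c = 0"
    and cocycle12: "\<And>a b c. hochschild_d2 mul1 f2 a b c + hochschild_d2 mul2 f1 a b c = 0"
    and cocycle2: "\<And>a b c. hochschild_d2 mul2 f2 a b c = 0"
  obtains g where "module_hom scale scale g"
    and "\<And>a b. hochschild_d1 mul1 g a b = f1 a b" and "\<And>a b. hochschild_d1 mul2 g a b = f2 a b"
proof -
  interpret compatible_algebra scale mul1 mul2 by fact
  define F :: "nat \<Rightarrow> 'b list \<Rightarrow> 'b" where
    "F = (\<lambda>i as. if i = 1 \<and> length as = 2 then f1 (as ! 0) (as ! 1)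
                 else if i = 2 \<and> length as = 2 then f2 (as ! 0) (as ! 1) else 0)"
  have F: "F 1 = (\<lambda>as. if length as = 2 then f1 (as ! 0) (as ! 1) else 0)"
    "F 2 = (\<lambda>as. if length as = 2 then f2 (as ! 0) (as ! 1) else 0)"
    by (simp_all add: F_def fun_eq_iff)
  have "F \<in> compatible_cochains scale mul1 mul2 2"
  proof -
    have "{1..max 1 2::nat} = {1, 2}" by auto
    moreover have "F 1 \<in> hochschild_cochains scale 2" "F 2 \<in> hochschild_cochains scale 2"
      unfolding F by (intro bilinear_2_cochain f1 f2)+
    moreover have "F i = 0" if "i \<notin> {1, 2}" for i
      using that by (simp add: F_def fun_eq_iff)
    ultimately show ?thesis
      unfolding compatible_cochains_def by simp
  qed
  moreover have "compatible_coboundary scale mul1 mul2 2 F i as = 0" for i as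
  proof (cases "length as = 3")
    case True
    then obtain a b c where "as = [a, b, c]" by (auto simp: length_Suc_conv numeral_eq_Suc)
    moreover have "i = 2" if "2 \<le> i" "i \<le> 2" using that by simp
    ultimately show ?thesis
      using cocycle1[of a b c] cocycle12[of a b c] cocycle2[of a b c]
      by (auto simp: compatible_coboundary_def hochschild_coboundary_2[OF module_axioms]
          F F[unfolded One_nat_def])
  next
    case False
    then show ?thesis
      by (simp add: compatible_coboundary_def hochschild_coboundary_other_length)
  qed
  ultimately have "F \<in> compatible_cocycles scale mul1 mul2 2"
    by (simp add: compatible_cocycles_def fun_eq_iff)
  then have "F \<in> compatible_coboundaries scale mul1 mul2 2"
    using compatible_cocycles_2_subset_coboundaries[OF alg H2] by blast
  then obtain G where G: "G \<in> compatible_cochains scale mul1 mul2 1"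
    and FG: "F = compatible_coboundary scale mul1 mul2 1 G"
    by (auto simp: compatible_coboundaries_def)
  show thesis
  proof
    have "G 1 \<in> hochschild_cochains scale 1"
      using G by (simp add: compatible_cochains_def)
    then have "length xs + 1 + length ys = 1 \<longrightarrow> module_hom scale scale (\<lambda>a. G 1 (xs @ a # ys))" for xs ys
      unfolding hochschild_cochains_def by blast
    from this[of "[]" "[]"] show "module_hom scale scale (\<lambda>a. G 1 [a])" by simp
    fix a b
    have "F 1 [a, b] = hochschild_d1 mul1 (\<lambda>a. G 1 [a]) a b"
      "F 2 [a, b] = hochschild_d1 mul2 (\<lambda>a. G 1 [a]) a b"
      unfolding FG compatible_coboundary_def
      by (simp_all add: hochschild_coboundary_1[OF module_axioms, simplified])
    then show "hochschild_d1 mul1 (\<lambda>a. G 1 [a]) a b = f1 a b"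
      "hochschild_d1 mul2 (\<lambda>a. G 1 [a]) a b = f2 a b"
      by (simp_all add: F F[unfolded One_nat_def])
  qed
qed

section \<open>Trivializing a deformation order by order\<close>

definition hom_defect ::
  "(nat \<Rightarrow> 'a \<Rightarrow> 'a) \<Rightarrow> (nat \<Rightarrow> 'a \<Rightarrow> 'a \<Rightarrow> 'a) \<Rightarrow> ('a \<Rightarrow> 'a \<Rightarrow> 'a) \<Rightarrow>
   'a::ab_group_add fps \<Rightarrow> 'a fps \<Rightarrow> 'a fps" where
  "hom_defect \<phi> M m x y =
     fps_map \<phi> (fps_product M x y) -
     fps_product (constant_series m) (fps_map \<phi> x) (fps_map \<phi> y)"

text \<open>The defect is constrained on constant series only, because these are the equations that the
  recursion for \<open>\<phi>\<close> solves; bilinearity over the power series ring extends them to all of \<open>A[[t]]\<close>.\<close>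

definition trivializes_below ::
  "('k::comm_ring_1 \<Rightarrow> 'a::ab_group_add \<Rightarrow> 'a) \<Rightarrow> (nat \<Rightarrow> 'a \<Rightarrow> 'a \<Rightarrow> 'a) \<Rightarrow> ('a \<Rightarrow> 'a \<Rightarrow> 'a) \<Rightarrow>
   (nat \<Rightarrow> 'a \<Rightarrow> 'a) \<Rightarrow> nat \<Rightarrow> bool" where
  "trivializes_below scale M m \<phi> n \<longleftrightarrow>
     (\<forall>i. bilinear_product scale (M i)) \<and> M 0 = m \<and>
     bilinear_product (fps_scale scale) (fps_product M) \<and>
     (\<forall>i. module_hom scale scale (\<phi> i)) \<and> \<phi> 0 = id \<and>
     (\<forall>a b. \<forall>k<n. fps_nth (hom_defect \<phi> M m (fps_const a) (fps_const b)) k = 0)"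

text \<open>For \<open>\<phi> 0 = id\<close>, \<open>M 0 = m\<close> and \<open>n > 0\<close>, the degree \<open>n\<close> part of the defect on constants contains \<open>\<phi> n\<close>
  only in the terms \<open>\<phi>\<^sub>n(m(a, b))\<close>, \<open>m(a, \<phi>\<^sub>n b)\<close> and \<open>m(\<phi>\<^sub>n a, b)\<close>, which make up
  \<open>- hochschild_d1 m (\<phi> n) a b\<close>. The obstruction is what remains.\<close>

definition obstruction ::
  "(nat \<Rightarrow> 'a \<Rightarrow> 'a) \<Rightarrow> (nat \<Rightarrow> 'a \<Rightarrow> 'a \<Rightarrow> 'a) \<Rightarrow> ('a \<Rightarrow> 'a \<Rightarrow> 'a) \<Rightarrow> nat \<Rightarrow>
   'a \<Rightarrow> 'a \<Rightarrow> 'a::ab_group_add" where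
  "obstruction \<phi> M m n a b =
     (\<Sum>i<n. \<phi> i (M (n - i) a b)) - (\<Sum>i\<in>{1..<n}. m (\<phi> i a) (\<phi> (n - i) b))"

text \<open>Write \<open>x = x\<^sub>0 + t x'\<close>. Then \<open>E(x, y) = E(x\<^sub>0, y) + t E(x', y)\<close>, and the degree \<open>k\<close> coefficient
  of \<open>t E(x', y)\<close> is one of degree \<open>k - 1\<close>, which by induction is already known to vanish; the same
  applies to \<open>y\<close>.\<close>

lemma bilinear_product_fps_coeff_eq_const:
  assumes scale: "module scale" and E: "bilinear_product (fps_scale scale) E"
    and zero: "\<And>a b k. k < n \<Longrightarrow> fps_nth (E (fps_const a) (fps_const b)) k = 0"
    and "k \<le> n"
  shows "fps_nth (E x y) k = fps_nth (E (fps_const (fps_nth x 0)) (fps_const (fps_nth y 0))) k"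
  using \<open>k \<le> n\<close>
proof (induction k arbitrary: x y)
  interpret module scale by fact
  note E_iff = E[unfolded bilinear_product_iff]
  have nth_X: "fps_nth (fps_scale scale fps_X z) k = (if k = 0 then 0 else fps_nth z (k - 1))" for z k
  proof -
    have "scale (fps_nth fps_X i) (fps_nth z (k - i)) = (if i = 1 then fps_nth z (k - 1) else 0)" for i
      by simp
    then show ?thesis by simp
  qed
  have split: "x = fps_const (fps_nth x 0) + fps_scale scale fps_X (fps_shift 1 x)" for x
    by (rule fps_ext) (simp add: nth_X del: fps_nth_fps_scale)
  have left: "fps_nth (E x y) k = fps_nth (E (fps_const (fps_nth x 0)) y) k +
      (if k = 0 then 0 else fps_nth (E (fps_shift 1 x) y) (k - 1))" for x y k
    by (subst split) (simp add: E_iff nth_X del: fps_nth_fps_scale)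
  have right: "fps_nth (E x y) k = fps_nth (E x (fps_const (fps_nth y 0))) k +
      (if k = 0 then 0 else fps_nth (E x (fps_shift 1 y)) (k - 1))" for x y k
    by (subst split[of y]) (simp add: E_iff nth_X del: fps_nth_fps_scale)
  {
    case 0
    show ?case by (simp add: left[of x y] right[of "fps_const (fps_nth x 0)" y])
  next
    case (Suc k)
    then have "fps_nth (E x y) k = 0" for x y
      using zero by simp
    then show ?case by (simp add: left[of x y] right[of "fps_const (fps_nth x 0)" y])
  }
qed

lemma fps_map_const:
  assumes "\<And>i. module_hom scale scale (\<phi> i)"
  shows "fps_nth (fps_map \<phi> (fps_const a)) n = \<phi> n a"
proof -
  interpret \<phi>: module_hom scale scale "\<phi> i" for i by fact
  have "\<phi> i (fps_nth (fps_const a) (n - i)) = (if i = n then \<phi> n a else 0)" if "i \<le> n" for i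
    using that by (simp add: \<phi>.zero)
  then show ?thesis by simp
qed

lemma fps_product_const:
  assumes "\<And>i. bilinear_product scale (M i)"
  shows "fps_nth (fps_product M (fps_const a) (fps_const b)) n = M n a b"
proof -
  note zero = bilinear_product_group_homs(1,2)[OF assms]
  have "(\<Sum>j\<le>n - i. M i (fps_nth (fps_const a) j) (fps_nth (fps_const b) (n - i - j))) =
      (if i = n then M n a b else 0)" if "i \<le> n" for i
  proof -
    have "M i (fps_nth (fps_const a) j) (fps_nth (fps_const b) (n - i - j)) =
        (if j = 0 then if i = n then M n a b else 0 else 0)" for j
      using that by (simp add: zero)
    then show ?thesis by simp
  qed
  then show ?thesis by (simp add: fps_nth_fps_product)
qed

lemma hom_defect_const:
  assumes \<phi>: "\<And>i. module_hom scale scale (\<phi> i)" and M: "\<And>i. bilinear_product scale (M i)"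
  shows "fps_nth (hom_defect \<phi> M m (fps_const a) (fps_const b)) n =
    (\<Sum>i\<le>n. \<phi> i (M (n - i) a b)) - (\<Sum>i\<le>n. m (\<phi> i a) (\<phi> (n - i) b))"
  by (simp add: hom_defect_def fps_map_const[OF \<phi>] fps_product_const[OF M] del: fps_nth_fps_map)
    (simp add: fps_product_const[OF M])

lemma hom_defect_const_eq_obstruction:
  assumes \<phi>: "\<And>i. module_hom scale scale (\<phi> i)" and M: "\<And>i. bilinear_product scale (M i)"
    and init: "\<phi> 0 = id" "M 0 = m" and "0 < n"
  shows "fps_nth (hom_defect \<phi> M m (fps_const a) (fps_const b)) n =
    obstruction \<phi> M m n a b - hochschild_d1 m (\<phi> n) a b"
proof -
  have "{..n} = insert n {..<n}"
    by auto
  then have "(\<Sum>i\<le>n. \<phi> i (M (n - i) a b)) = \<phi> n (m a b) + (\<Sum>i<n. \<phi> i (M (n - i) a b))"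
    using init by simp
  moreover have "{..n} = insert 0 (insert n {1..<n})"
    using \<open>0 < n\<close> by auto
  then have "(\<Sum>i\<le>n. m (\<phi> i a) (\<phi> (n - i) b)) =
      m a (\<phi> n b) + (m (\<phi> n a) b + (\<Sum>i\<in>{1..<n}. m (\<phi> i a) (\<phi> (n - i) b)))"
    using \<open>0 < n\<close> init by simp
  ultimately show ?thesis
    by (simp add: hom_defect_const[OF \<phi> M] obstruction_def hochschild_d1_def)
qed

lemma trivializes_belowI:
  assumes \<phi>: "\<And>i. module_hom scale scale (\<phi> i)" and M: "\<And>i. bilinear_product scale (M i)"
    and init: "\<phi> 0 = id" "M 0 = m"
    and "bilinear_product (fps_scale scale) (fps_product M)"
    and solves: "\<And>k a b. 0 < k \<Longrightarrow> k < n \<Longrightarrow>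
      hochschild_d1 m (\<phi> k) a b = obstruction \<phi> M m k a b"
  shows "trivializes_below scale M m \<phi> n"
proof -
  have "fps_nth (hom_defect \<phi> M m (fps_const a) (fps_const b)) k = 0" if "k < n" for a b k
  proof (cases "k = 0")
    case True
    then show ?thesis
      by (simp add: hom_defect_const[where \<phi> = \<phi> and M = M, OF \<phi> M] init)
  next
    case False
    then show ?thesis
      using hom_defect_const_eq_obstruction[where \<phi> = \<phi> and M = M and m = m and n = k, OF \<phi> M init]
        solves that by simp
  qed
  then show ?thesis
    using assms by (simp add: trivializes_below_def)
qed

lemma bilinear_product_hom_defect:
  assumes "bilinear_product (fps_scale scale) (fps_product M)" "bilinear_product scale m"
    and \<phi>: "\<And>i. module_hom scale scale (\<phi> i)"
  shows "bilinear_product (fps_scale scale) (hom_defect \<phi> M m)"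
proof -
  interpret \<Phi>: module_hom "fps_scale scale" "fps_scale scale" "fps_map \<phi>"
    by (rule module_hom_fps_map) (rule \<phi>)
  show ?thesis
    using assms(1) bilinear_product_constant_series[OF assms(2)]
    by (simp add: bilinear_product_iff hom_defect_def \<Phi>.add \<Phi>.scale \<Phi>.m1.scale_right_diff_distrib)
qed

lemma bilinear_obstruction:
  assumes "\<And>i. module_hom scale scale (\<phi> i)" "\<And>i. bilinear_product scale (M i)"
    "bilinear_product scale m"
  shows "bilinear_product scale (obstruction \<phi> M m n)"
proof -
  interpret \<phi>: module_hom scale scale "\<phi> i" for i by fact
  show ?thesis
    using assms(2,3)
    by (simp add: bilinear_product_iff obstruction_def \<phi>.add \<phi>.scale sum.distrib
        \<phi>.m1.scale_right_diff_distrib \<phi>.m1.scale_sum_right)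
qed

lemma trivializes_below_hom_defect_nth:
  assumes "trivializes_below scale M m \<phi> n" and "k \<le> n"
  shows "fps_nth (hom_defect \<phi> M m x y) k =
    fps_nth (hom_defect \<phi> M m (fps_const (fps_nth x 0)) (fps_const (fps_nth y 0))) k"
proof (rule bilinear_product_fps_coeff_eq_const[OF _ _ _ \<open>k \<le> n\<close>])
  have "bilinear_product scale m"
    using assms(1) unfolding trivializes_below_def by blast
  then show "bilinear_product (fps_scale scale) (hom_defect \<phi> M m)" "module scale"
    using assms(1) by (auto intro!: bilinear_product_hom_defect
        simp: trivializes_below_def bilinear_product_iff[of scale])
qed (use assms(1) in \<open>simp add: trivializes_below_def\<close>)

text \<open>Passing from \<open>\<phi>(M'(M(a, b), c))\<close> to \<open>\<mu>'(\<mu>(\<phi> a, \<phi> b), \<phi> c)\<close> by replacing first \<open>M'\<close> and then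
  \<open>M\<close> costs \<open>E'(M(a, b), c) + \<mu>'(E(a, b), \<phi> c)\<close>. As the defects have no terms below degree \<open>n\<close>,
  only the degree 0 parts of \<open>M(a, b)\<close> and \<open>\<phi> c\<close>, which are \<open>m a b\<close> and \<open>c\<close>, contribute in degree
  \<open>n\<close>. The two products may differ, as the compatibility identity requires.\<close>

lemma hom_defect_left_nested:
  assumes triv: "trivializes_below scale M m \<phi> n" and triv': "trivializes_below scale M' m' \<phi> n"
  shows "fps_nth (fps_map \<phi> (fps_product M' (fps_product M (fps_const a) (fps_const b)) (fps_const c))
      - fps_product (constant_series m') (fps_product (constant_series m)
          (fps_map \<phi> (fps_const a)) (fps_map \<phi> (fps_const b))) (fps_map \<phi> (fps_const c))) n =
    fps_nth (hom_defect \<phi> M' m' (fps_const (m a b)) (fps_const c)) n +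
    m' (fps_nth (hom_defect \<phi> M m (fps_const a) (fps_const b)) n) c"
proof -
  let ?A = "fps_const a" and ?B = "fps_const b" and ?C = "fps_const c"
  let ?\<mu> = "fps_product (constant_series m)" and ?\<mu>' = "fps_product (constant_series m')"
  let ?E = "hom_defect \<phi> M m ?A ?B"
  have bil: "bilinear_product scale (M i)" "bilinear_product scale m'"
    and \<phi>: "module_hom scale scale (\<phi> i)" and init: "M 0 = m" "\<phi> 0 = id" for i
    using triv triv' by (auto simp: trivializes_below_def)
  have low: "fps_nth ?E k = 0" if "k < n" for k
    using triv that by (simp add: trivializes_below_def)
  have "fps_map \<phi> (fps_product M' (fps_product M ?A ?B) ?C)
      - ?\<mu>' (?\<mu> (fps_map \<phi> ?A) (fps_map \<phi> ?B)) (fps_map \<phi> ?C) =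
      hom_defect \<phi> M' m' (fps_product M ?A ?B) ?C + ?\<mu>' ?E (fps_map \<phi> ?C)"
    by (simp add: hom_defect_def
        bilinear_product_group_homs[OF bilinear_product_constant_series[OF bil(2)]])
  moreover have "fps_nth (hom_defect \<phi> M' m' (fps_product M ?A ?B) ?C) n =
      fps_nth (hom_defect \<phi> M' m' (fps_const (m a b)) ?C) n"
    by (subst trivializes_below_hom_defect_nth[OF triv'])
      (simp_all add: fps_product_const[OF bil(1)] init)
  moreover have "fps_nth (?\<mu>' ?E (fps_map \<phi> ?C)) n = m' (fps_nth ?E n) c"
  proof -
    have "m' (fps_nth ?E j) (fps_nth (fps_map \<phi> ?C) (n - j)) =
        (if j = n then m' (fps_nth ?E n) c else 0)" if "j \<le> n" for j
      using that low[of j] init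
      by (simp add: fps_map_const[OF \<phi>] bilinear_product_group_homs[OF bil(2)] del: fps_nth_fps_map)
    then show ?thesis by (simp del: fps_nth_fps_map)
  qed
  ultimately show ?thesis by simp
qed

lemma hom_defect_right_nested:
  assumes triv: "trivializes_below scale M m \<phi> n" and triv': "trivializes_below scale M' m' \<phi> n"
  shows "fps_nth (fps_map \<phi> (fps_product M' (fps_const a) (fps_product M (fps_const b) (fps_const c)))
      - fps_product (constant_series m') (fps_map \<phi> (fps_const a)) (fps_product (constant_series m)
          (fps_map \<phi> (fps_const b)) (fps_map \<phi> (fps_const c)))) n =
    fps_nth (hom_defect \<phi> M' m' (fps_const a) (fps_const (m b c))) n +
    m' a (fps_nth (hom_defect \<phi> M m (fps_const b) (fps_const c)) n)"
proof -
  let ?A = "fps_const a" and ?B = "fps_const b" and ?C = "fps_const c"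
  let ?\<mu> = "fps_product (constant_series m)" and ?\<mu>' = "fps_product (constant_series m')"
  let ?E = "hom_defect \<phi> M m ?B ?C"
  have bil: "bilinear_product scale (M i)" "bilinear_product scale m'"
    and \<phi>: "module_hom scale scale (\<phi> i)" and init: "M 0 = m" "\<phi> 0 = id" for i
    using triv triv' by (auto simp: trivializes_below_def)
  have low: "fps_nth ?E k = 0" if "k < n" for k
    using triv that by (simp add: trivializes_below_def)
  have "fps_map \<phi> (fps_product M' ?A (fps_product M ?B ?C))
      - ?\<mu>' (fps_map \<phi> ?A) (?\<mu> (fps_map \<phi> ?B) (fps_map \<phi> ?C)) =
      hom_defect \<phi> M' m' ?A (fps_product M ?B ?C) + ?\<mu>' (fps_map \<phi> ?A) ?E"
    by (simp add: hom_defect_def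
        bilinear_product_group_homs[OF bilinear_product_constant_series[OF bil(2)]])
  moreover have "fps_nth (hom_defect \<phi> M' m' ?A (fps_product M ?B ?C)) n =
      fps_nth (hom_defect \<phi> M' m' ?A (fps_const (m b c))) n"
    by (subst trivializes_below_hom_defect_nth[OF triv'])
      (simp_all add: fps_product_const[OF bil(1)] init)
  moreover have "fps_nth (?\<mu>' (fps_map \<phi> ?A) ?E) n = m' a (fps_nth ?E n)"
  proof -
    have "m' (fps_nth (fps_map \<phi> ?A) j) (fps_nth ?E (n - j)) =
        (if j = 0 then m' a (fps_nth ?E n) else 0)" if "j \<le> n" for j
      using that low[of "n - j"] init
      by (cases "j = 0")
        (simp_all add: fps_map_const[OF \<phi>] bilinear_product_group_homs[OF bil(2)] del: fps_nth_fps_map)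
    then show ?thesis by (simp del: fps_nth_fps_map)
  qed
  ultimately show ?thesis by simp
qed

text \<open>The left-hand sides of the two preceding lemmas agree, for equal products by associativity and
  for different ones, after adding the terms with the products exchanged, by compatibility. The
  right-hand sides then give the components of the cocycle condition.\<close>

lemma hom_defect_compatible_2_cocycle:
  fixes scale :: "'k::comm_ring_1 \<Rightarrow> 'a::ab_group_add \<Rightarrow> 'a"
  assumes alg: "compatible_algebra scale mul1 mul2"
    and def: "compatible_algebra (fps_scale scale) (fps_product M1) (fps_product M2)"
    and triv1: "trivializes_below scale M1 mul1 \<phi> n" and triv2: "trivializes_below scale M2 mul2 \<phi> n"
  defines "f1 \<equiv> \<lambda>a b. fps_nth (hom_defect \<phi> M1 mul1 (fps_const a) (fps_const b)) n"
    and "f2 \<equiv> \<lambda>a b. fps_nth (hom_defect \<phi> M2 mul2 (fps_const a) (fps_const b)) n"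
  shows "hochschild_d2 mul1 f1 a b c = 0"
    and "hochschild_d2 mul1 f2 a b c + hochschild_d2 mul2 f1 a b c = 0"
    and "hochschild_d2 mul2 f2 a b c = 0"
proof -
  interpret M: compatible_algebra "fps_scale scale" "fps_product M1" "fps_product M2" by fact
  interpret \<mu>: compatible_algebra "fps_scale scale"
      "fps_product (constant_series mul1)" "fps_product (constant_series mul2)"
    by (rule compatible_algebra_constant_series) fact
  have "module_hom scale scale (\<phi> i)" for i
    using triv1 by (simp add: trivializes_below_def)
  then interpret \<Phi>: module_hom "fps_scale scale" "fps_scale scale" "fps_map \<phi>"
    by (rule module_hom_fps_map)
  let ?A = "fps_const a" and ?B = "fps_const b" and ?C = "fps_const c"
  show "hochschild_d2 mul1 f1 a b c = 0"
    using hom_defect_left_nested[OF triv1 triv1, of a b c] hom_defect_right_nested[OF triv1 triv1, of a b c]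
    unfolding M.assoc1 \<mu>.assoc1 by (simp add: hochschild_d2_def f1_def algebra_simps)
  show "hochschild_d2 mul2 f2 a b c = 0"
    using hom_defect_left_nested[OF triv2 triv2, of a b c] hom_defect_right_nested[OF triv2 triv2, of a b c]
    unfolding M.assoc2 \<mu>.assoc2 by (simp add: hochschild_d2_def f2_def algebra_simps)
  let ?l = "\<lambda>M' M. fps_map \<phi> (fps_product M' (fps_product M ?A ?B) ?C)"
    and ?r = "\<lambda>M' M. fps_map \<phi> (fps_product M' ?A (fps_product M ?B ?C))"
    and ?l' = "\<lambda>m' m. fps_product (constant_series m') (fps_product (constant_series m)
          (fps_map \<phi> ?A) (fps_map \<phi> ?B)) (fps_map \<phi> ?C)"
    and ?r' = "\<lambda>m' m. fps_product (constant_series m') (fps_map \<phi> ?A) (fps_product (constant_series m)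
          (fps_map \<phi> ?B) (fps_map \<phi> ?C))"
  have "?l M2 M1 + ?l M1 M2 = ?r M1 M2 + ?r M2 M1"
    by (simp only: \<Phi>.add[symmetric] M.compatible)
  moreover have "?l' mul2 mul1 + ?l' mul1 mul2 = ?r' mul1 mul2 + ?r' mul2 mul1"
    by (rule \<mu>.compatible)
  ultimately have "(?l M2 M1 - ?l' mul2 mul1) + (?l M1 M2 - ?l' mul1 mul2) =
      (?r M1 M2 - ?r' mul1 mul2) + (?r M2 M1 - ?r' mul2 mul1)"
    by (metis add_diff_add)
  then have "fps_nth (?l M2 M1 - ?l' mul2 mul1) n + fps_nth (?l M1 M2 - ?l' mul1 mul2) n =
      fps_nth (?r M1 M2 - ?r' mul1 mul2) n + fps_nth (?r M2 M1 - ?r' mul2 mul1) n"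
    by (metis fps_add_nth)
  then show "hochschild_d2 mul1 f2 a b c + hochschild_d2 mul2 f1 a b c = 0"
    unfolding hom_defect_left_nested[OF triv1 triv2] hom_defect_left_nested[OF triv2 triv1]
      hom_defect_right_nested[OF triv1 triv2] hom_defect_right_nested[OF triv2 triv1]
    by (simp add: hochschild_d2_def f1_def f2_def algebra_simps)
qed

text \<open>The recursion step: only the coefficients of \<open>\<phi>\<close> below \<open>n\<close> are constrained, and they already
  make the pair of degree \<open>n\<close> obstructions a cocycle.\<close>

lemma next_coefficient_exists:
  fixes scale :: "'k::comm_ring_1 \<Rightarrow> 'a::ab_group_add \<Rightarrow> 'a"
  assumes alg: "compatible_algebra scale mul1 mul2"
    and H2: "compatible_cohomology scale mul1 mul2 2 = {compatible_coboundaries scale mul1 mul2 2}"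
    and def: "formal_deformation scale mul1 mul2 M1 M2"
    and \<phi>: "\<And>i. i < n \<Longrightarrow> module_hom scale scale (\<phi> i)" and \<phi>0: "\<phi> 0 = id" and "0 < n"
    and below: "\<And>i a b. 0 < i \<Longrightarrow> i < n \<Longrightarrow>
      hochschild_d1 mul1 (\<phi> i) a b = obstruction \<phi> M1 mul1 i a b \<and>
      hochschild_d1 mul2 (\<phi> i) a b = obstruction \<phi> M2 mul2 i a b"
  obtains g where "module_hom scale scale g"
    and "\<And>a b. hochschild_d1 mul1 g a b = obstruction \<phi> M1 mul1 n a b"
    and "\<And>a b. hochschild_d1 mul2 g a b = obstruction \<phi> M2 mul2 n a b"
proof -
  interpret compatible_algebra scale mul1 mul2 by fact
  have M: "\<And>i. bilinear_product scale (M1 i)" "\<And>i. bilinear_product scale (M2 i)" "M1 0 = mul1" "M2 0 = mul2"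
    and M_alg: "compatible_algebra (fps_scale scale) (fps_product M1) (fps_product M2)"
    using def by (auto simp: formal_deformation_def)
  \<comment> \<open>The later values of \<open>\<phi>\<close> are arbitrary, possibly not even linear. With the zero map as degree
    \<open>n\<close> coefficient, the degree \<open>n\<close> defect becomes the obstruction itself.\<close>
  define \<psi> where "\<psi> = (\<lambda>i. if i < n then \<phi> i else (\<lambda>a. 0))"
  have \<psi>: "module_hom scale scale (\<psi> i)" for i
    using \<phi>[of i] by (auto simp: \<psi>_def module_hom_iff module_axioms)
  have \<psi>0: "\<psi> 0 = id"
    using \<phi>0 \<open>0 < n\<close> by (simp add: \<psi>_def)
  have obstruction_\<psi>: "obstruction \<psi> M m i a b = obstruction \<phi> M m i a b" if "i \<le> n" for M m i a b
    using that by (auto simp: obstruction_def \<psi>_def intro!: arg_cong2[where f = "(-)"] sum.cong)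
  have \<psi>n: "hochschild_d1 m (\<psi> n) a b = 0" if "bilinear_product scale m" for m a b
    by (simp add: hochschild_d1_def \<psi>_def bilinear_product_group_homs[OF that])
  have solves: "hochschild_d1 mul1 (\<psi> k) a b = obstruction \<psi> M1 mul1 k a b"
    "hochschild_d1 mul2 (\<psi> k) a b = obstruction \<psi> M2 mul2 k a b" if "0 < k" "k < n" for k a b
    using below[OF that, of a b] that by (simp_all add: obstruction_\<psi>) (simp_all add: \<psi>_def)
  have triv1: "trivializes_below scale M1 mul1 \<psi> n"
    using M_alg by (intro trivializes_belowI \<psi> \<psi>0 M solves compatible_algebra.bilinear1)
  have triv2: "trivializes_below scale M2 mul2 \<psi> n"
    using M_alg by (intro trivializes_belowI \<psi> \<psi>0 M solves compatible_algebra.bilinear2)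
  have nth_n: "(\<lambda>a b. fps_nth (hom_defect \<psi> M1 mul1 (fps_const a) (fps_const b)) n) = obstruction \<psi> M1 mul1 n"
    "(\<lambda>a b. fps_nth (hom_defect \<psi> M2 mul2 (fps_const a) (fps_const b)) n) = obstruction \<psi> M2 mul2 n"
    using hom_defect_const_eq_obstruction[where \<phi> = \<psi> and M = M1, OF \<psi> M(1) \<psi>0 M(3) \<open>0 < n\<close>]
      hom_defect_const_eq_obstruction[where \<phi> = \<psi> and M = M2, OF \<psi> M(2) \<psi>0 M(4) \<open>0 < n\<close>]
    by (simp_all add: \<psi>n bilinear1 bilinear2)
  note cocycle =
    hom_defect_compatible_2_cocycle[OF alg M_alg triv1 triv2, unfolded nth_n]
  obtain g where "module_hom scale scale g"
    "\<And>a b. hochschild_d1 mul1 g a b = obstruction \<psi> M1 mul1 n a b"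
    "\<And>a b. hochschild_d1 mul2 g a b = obstruction \<psi> M2 mul2 n a b"
    using compatible_2_cocycle_is_coboundary[OF alg H2
        bilinear_obstruction[OF \<psi> M(1) bilinear1] bilinear_obstruction[OF \<psi> M(2) bilinear2] cocycle]
    by blast
  then show thesis
    by (intro that) (simp_all add: obstruction_\<psi>)
qed

lemma trivialization_is_hom:
  assumes "\<And>n. trivializes_below scale M m \<phi> n"
  shows "fps_map \<phi> (fps_product M x y) =
    fps_product (constant_series m) (fps_map \<phi> x) (fps_map \<phi> y)"
proof -
  have "fps_nth (hom_defect \<phi> M m x y) k = 0" for k
    using trivializes_below_hom_defect_nth[OF assms[of "Suc k"], of k x y] assms[of "Suc k"]
    by (simp add: trivializes_below_def)
  then have "hom_defect \<phi> M m x y = 0"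
    by (simp add: fps_eq_iff)
  then show ?thesis by (simp add: hom_defect_def)
qed

lemma rigid_if_compatible_cohomology_2_zero:
  fixes scale :: "'k::comm_ring_1 \<Rightarrow> 'a::ab_group_add \<Rightarrow> 'a"
  assumes alg: "compatible_algebra scale mul1 mul2"
    and H2: "compatible_cohomology scale mul1 mul2 2 = {compatible_coboundaries scale mul1 mul2 2}"
  shows "rigid scale mul1 mul2"
  unfolding rigid_def
proof (intro allI impI)
  interpret compatible_algebra scale mul1 mul2 by fact
  fix M1 M2 assume def: "formal_deformation scale mul1 mul2 M1 M2"
  then have M: "\<And>i. bilinear_product scale (M1 i)" "\<And>i. bilinear_product scale (M2 i)" "M1 0 = mul1" "M2 0 = mul2"
    and M_alg: "compatible_algebra (fps_scale scale) (fps_product M1) (fps_product M2)"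
    by (auto simp: formal_deformation_def)
  let ?step = "\<lambda>\<phi> n g. module_hom scale scale g \<and> (if n = 0 then g = id else
      \<forall>a b. hochschild_d1 mul1 g a b = obstruction \<phi> M1 mul1 n a b \<and>
            hochschild_d1 mul2 g a b = obstruction \<phi> M2 mul2 n a b)"
  have "\<exists>\<phi>. \<forall>n. ?step \<phi> n (\<phi> n)"
  proof (rule dependent_wf_choice)
    show "wf {(i, n::nat). i < n}" by (rule wf_less)
  next
    fix \<phi> \<phi>' :: "nat \<Rightarrow> 'a \<Rightarrow> 'a" and n g
    assume "\<And>i. (i, n) \<in> {(i, n). i < n} \<Longrightarrow> \<phi> i = \<phi>' i"
    then have "obstruction \<phi> M m n a b = obstruction \<phi>' M m n a b" for M m a b
      by (simp add: obstruction_def)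
    then show "?step \<phi> n g = ?step \<phi>' n g" by simp
  next
    fix \<phi> n assume "\<And>i. (i, n) \<in> {(i, n). i < n} \<Longrightarrow> ?step \<phi> i (\<phi> i)"
    then have prev: "?step \<phi> i (\<phi> i)" if "i < n" for i
      using that by simp
    show "\<exists>g. ?step \<phi> n g"
    proof (cases "n = 0")
      case True
      then show ?thesis using module_hom_id by simp
    next
      case False
      obtain g where "module_hom scale scale g"
        "\<And>a b. hochschild_d1 mul1 g a b = obstruction \<phi> M1 mul1 n a b"
        "\<And>a b. hochschild_d1 mul2 g a b = obstruction \<phi> M2 mul2 n a b"
      proof (rule next_coefficient_exists[OF alg H2 def, of n \<phi>])
        show "\<phi> 0 = id" using prev[of 0] False by simp
      qed (use prev False in \<open>auto split: if_splits\<close>)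
      then show ?thesis using False by auto
    qed
  qed
  then obtain \<phi> where step: "\<And>n. ?step \<phi> n (\<phi> n)" by blast
  then have \<phi>: "module_hom scale scale (\<phi> i)" for i by blast
  have \<phi>0: "\<phi> 0 = id" using step[of 0] by simp
  have solves: "hochschild_d1 mul1 (\<phi> k) a b = obstruction \<phi> M1 mul1 k a b"
    "hochschild_d1 mul2 (\<phi> k) a b = obstruction \<phi> M2 mul2 k a b" if "0 < k" for k a b
    using step[of k] that by simp_all
  have "trivializes_below scale M1 mul1 \<phi> n" for n
    using M_alg by (intro trivializes_belowI \<phi> \<phi>0 M solves compatible_algebra.bilinear1)
  moreover have "trivializes_below scale M2 mul2 \<phi> n" for n
    using M_alg by (intro trivializes_belowI \<phi> \<phi>0 M solves compatible_algebra.bilinear2)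
  ultimately show "equivalent_deformations scale M1 M2 (constant_series mul1) (constant_series mul2)"
    unfolding equivalent_deformations_def compatible_algebra_hom_def
    using \<phi> \<phi>0 by (blast intro: module_hom_fps_map trivialization_is_hom)
qed

theorem theorem4p6:
  fixes scale :: "'k::field_char_0 \<Rightarrow> 'a::ab_group_add \<Rightarrow> 'a"
    and Basis :: "'a set"
    and mul1 mul2 :: "'a \<Rightarrow> 'a \<Rightarrow> 'a"
  assumes "finite_dimensional_vector_space scale Basis"
    and "compatible_algebra scale mul1 mul2"
    and "compatible_cohomology scale mul1 mul2 2 = {compatible_coboundaries scale mul1 mul2 2}"
  shows "rigid scale mul1 mul2"
  using assms(2,3) by (rule rigid_if_compatible_cohomology_2_zero)

end
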